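(* Let $A,B\in\mathbb{C}[x]$ with $A\neq 0$, $\deg A\le 2$, $\deg B=1$, let $w$ be a solution of $(Aw)'=Bw$ on an interval $D$, and suppose the standing assumptions (S1)–(S4) listed in the context hold. Let $\rho\in\{\mathrm{I},\mathrm{II},\mathrm{III}\}$ be a type that is available for the pair $(A,B)$ (i.e. $\rho\in\mathbb{G}$), let $j\in\mathbb{Z}_{\ge 0}$, let $p_{\rho,j}$ be the polynomial part of the corresponding quasi-polynomial eigenfunction, and let $\widehat P^{(\rho,j)}_n$ be the associated exceptional polynomials ($X_j$-OPs) of type $\rho$, with the convention $\widehat P^{(\rho,j)}_n\equiv 0$ for $n<0$. Let $$I_j(x)=\int p_{\rho,j}(x)\,dx$$ be an antiderivative of $p_{\rho,j}$. Then for every $n\in\mathbb{N}_{\rho,j}=\{n\in\mathbb{Z}_{\ge0}\mid \widehat P^{(\rho,j)}_n\neq 0\}$ there exist constants $\beta_{n,l}$ (independent of $x$), $-j-1\le l\le j+1$, such that $$I_j(x)\,\widehat P^{(\rho,j)}_n(x)=\sum_{l=-j-1}^{j+1}\beta_{n,l}\,\widehat P^{(\rho,j)}_{n+l}(x).$$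
   Context: Operator. $\mathcal{L}=A(x)\partial^2+B(x)\partial$, $\partial=\frac{d}{dx}$. Types and gauge data. To each type $\gamma\in\mathbb{G}$ one attaches a rational function $\eta_\gamma$ (the logarithmic derivative $\xi_\gamma'/\xi_\gamma$ of a gauge factor $\xi_\gamma=\exp\int\eta_\gamma\,dx$) and a polynomial $A_\gamma$: - $\gamma=\varnothing$ (always in $\mathbb{G}$): $\eta_\varnothing=0$, $A_\varnothing=1$. - $\gamma=\mathrm{III}$ (in $\mathbb{G}$ whenever $B\ne A'$; if $B=A'$ it is identified with $\varnothing$): $\eta_{\mathrm{III}}=(A'-B)/A$, $A_{\mathrm{III}}=A$. - $\gamma=\mathrm{I},\mathrm{II}$ are in $\mathbb{G}$ only in the following two cases. (1) $A=a_0(x-a_1)(x-a_2)$ with $a_0\neq0$, $a_1\ne a_2$, and $B-A'$ has no common root with $A$. Then $\eta_{\mathrm{I}}=\dfrac{A'(a_1)-B(a_1)}{A'(a_1)\,(x-a_1)}$, $\eta_{\mathrm{II}}=\dfrac{A'(a_2)-B(a_2)}{A'(a_2)\,(x-a_2)}$, and $A_{\mathrm{I}}$, $A_{\mathrm{II}}$ are nonzero constant multiples of $x-a_1$, $x-a_2$ respectively, normalized by $A_{\mathrm{I}}A_{\mathrm{II}}=A$. (2) $A=a_0(x-a_1)$ with $a_0\ne0$, and $B-A'$ has no common root with $A$. Then $\eta_{\mathrm{I}}=\dfrac{a_0-B(a_1)}{a_0(x-a_1)}$, $A_{\mathrm{I}}=A$, and $\eta_{\mathrm{II}}=-B'/a_0$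 (a constant), $A_{\mathrm{II}}=1$. Quasi-polynomial eigenfunctions. For $\gamma\in\mathbb{G}$, the conjugated operator $\xi_\gamma^{-1}\circ\mathcal{L}\circ\xi_\gamma=A\partial^2+(B+2A\eta_\gamma)\partial+c_\gamma$, where $c_\gamma=A(\eta_\gamma'+\eta_\gamma^2)+B\eta_\gamma$ is a constant, has polynomial coefficients. For $n\in\mathbb{Z}_{\ge0}$, $p_{\gamma,n}$ denotes the monic polynomial of degree $n$ with $A p_{\gamma,n}''+(B+2A\eta_\gamma)p_{\gamma,n}'+c_\gamma p_{\gamma,n}=\lambda_{\gamma,n}p_{\gamma,n}$; equivalently $\phi_{\gamma,n}=\xi_\gamma p_{\gamma,n}$ satisfies $\mathcal{L}[\phi_{\gamma,n}]=\lambda_{\gamma,n}\phi_{\gamma,n}$. Write $P_n=p_{\varnothing,n}$ (the classical orthogonal polynomials). Exceptional polynomials. - For $\rho\in\{\mathrm{I},\mathrm{II}\}$ and $n\ge0$: $\widehat P_n^{(\rho,j)}=A_\rho\left(p_{\rho,j}P_n'-(\eta_\rho p_{\rho,j}+p_{\rho,j}')P_n\right)$, a polynomial of degree $n+j$. So $\mathbb{N}_{\rho,j}=\mathbb{Z}_{\ge0}$. - For $\rho=\mathrm{III}$: $\widehat P_0^{(\mathrm{III},j)}=1$ (up to a nonzero constant factor); $\widehat P_n^{(\mathrm{III},j)}=A_{\mathrm{III}}\left(p_{\mathrm{III},j}P_{n-j-1}'-(\eta_{\mathrm{III}}p_{\mathrm{III},j}+p_{\mathrm{III},j}')P_{n-j-1}\right)$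 for $n\ge j+1$, a polynomial of degree $n$; and $\widehat P_n^{(\mathrm{III},j)}=0$ for $1\le n\le j$. So $\mathbb{N}_{\mathrm{III},j}=\{0\}\cup\{n\ge j+1\}$. Standing assumptions. (S1) For all $\gamma\in\mathbb{G}$ and $n\in\mathbb{Z}_{\ge0}$: $\frac{n}{2}A''+B'+2(A\eta_\gamma)'\ne0$ (so that every $p_{\gamma,n}$ exists and is unique). (S2) The numbers $\lambda_{\gamma,n}$, $(\gamma,n)\in\mathbb{G}\times\mathbb{Z}_{\ge0}$, are pairwise distinct. (S3) $D\subset\mathbb{R}\cup\{\pm\infty\}$ is an interval with $A(x)w(x)=0$ on $\partial D$ (in the limiting sense) and $\int_D P_mP_n\,w\,dx=h_n\delta_{mn}$ with $h_n\neq0$. (S4) The exceptional polynomials are orthogonal on $D$: for $n,m\in\mathbb{N}_{\rho,j}$, the integrals converge and $$\int_D \widehat P_n^{(\rho,j)}(x)\,\widehat P_m^{(\rho,j)}(x)\,\frac{A(x)w(x)}{(A_\rho(x)p_{\rho,j}(x))^2}\,dx=\widehat h_n^{(\rho,j)}\delta_{nm},\qquad \widehat h_n^{(\rho,j)}\ne0.$$ *)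

theory Defs
  imports
    "HOL-Analysis.Analysis"
    "HOL-Computational_Algebra.Computational_Algebra"
begin

text \<open>
  Rational functions are elements of the fraction field of \<^typ>\<open>complex poly\<close>; the formal
  derivative is extended to them by the quotient rule.
\<close>

type_synonym ratfun = "complex poly fract"

definition rderiv :: "ratfun \<Rightarrow> ratfun" where
  "rderiv f =
     (THE g. \<exists>a b. b \<noteq> 0 \<and> f = Fract a b \<and> g = Fract (pderiv a * b - a * pderiv b) (b * b))"

lemma rderiv_Fract:
  assumes b: "b \<noteq> 0"
  shows "rderiv (Fract a b) = Fract (pderiv a * b - a * pderiv b) (b * b)"
  unfolding rderiv_def
proof (rule the_equality)
  show "\<exists>c d. d \<noteq> 0 \<and> Fract a b = Fract c d \<and>
      Fract (pderiv a * b - a * pderiv b) (b * b) = Fract (pderiv c * d - c * pderiv d) (d * d)"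
    using b by blast
next
  fix g
  assume "\<exists>c d. d \<noteq> 0 \<and> Fract a b = Fract c d \<and> g = Fract (pderiv c * d - c * pderiv d) (d * d)"
  then obtain c d where d: "d \<noteq> 0" and eq: "Fract a b = Fract c d"
    and g: "g = Fract (pderiv c * d - c * pderiv d) (d * d)" by blast
  from eq have e: "a * d = c * b" using b d by (simp add: eq_fract)
  from arg_cong[OF e, of pderiv]
  have e': "pderiv a * d = c * pderiv b + b * pderiv c - a * pderiv d"
    by (simp add: pderiv_mult algebra_simps)
  have "(pderiv a * b - a * pderiv b) * (d * d) =
      b * d * (pderiv a * d) - d * pderiv b * (a * d)"
    by (simp add: algebra_simps)
  also have "\<dots> = b * d * (c * pderiv b + b * pderiv c) - b * pderiv d * (a * d) - d * pderiv b * (a * d)"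
    unfolding e' by (simp add: algebra_simps)
  also have "\<dots> = (pderiv c * d - c * pderiv d) * (b * b)"
    unfolding e by (simp add: algebra_simps)
  finally show "g = Fract (pderiv a * b - a * pderiv b) (b * b)"
    using b d by (simp add: g eq_fract)
qed

datatype gtype = Empty | I | II | III

definition case1 :: "complex poly \<Rightarrow> complex poly \<Rightarrow> complex \<Rightarrow> complex \<Rightarrow> complex \<Rightarrow> bool" where
  "case1 A B a0 a1 a2 \<longleftrightarrow>
     a0 \<noteq> 0 \<and> a1 \<noteq> a2 \<and> A = smult a0 ([:-a1, 1:] * [:-a2, 1:]) \<and>
     \<not> (\<exists>x. poly (B - pderiv A) x = 0 \<and> poly A x = 0)"

definition case2 :: "complex poly \<Rightarrow> complex poly \<Rightarrow> complex \<Rightarrow> complex \<Rightarrow> bool" where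
  "case2 A B a0 a1 \<longleftrightarrow>
     a0 \<noteq> 0 \<and> A = smult a0 [:-a1, 1:] \<and>
     \<not> (\<exists>x. poly (B - pderiv A) x = 0 \<and> poly A x = 0)"

definition gtypes :: "complex poly \<Rightarrow> complex poly \<Rightarrow> gtype set" where
  "gtypes A B =
     {Empty} \<union> {\<gamma>. \<gamma> = III \<and> B \<noteq> pderiv A} \<union>
     {\<gamma>. \<gamma> \<in> {I, II} \<and> ((\<exists>a0 a1 a2. case1 A B a0 a1 a2) \<or> (\<exists>a0 a1. case2 A B a0 a1))}"

text \<open>
  \<open>gauge_data A B \<eta> Ag\<close>: the functions \<open>\<eta>\<close> and \<open>Ag\<close> are an admissible assignment of
  \<open>\<eta>\<^sub>\<gamma>\<close> and \<open>A\<^sub>\<gamma>\<close> to the types. It is a relation because, for quadratic \<open>A\<close>, the data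
  depend on the labelling \<open>a1\<close>, \<open>a2\<close> of the roots and on how the leading coefficient is
  distributed over \<open>A\<^sub>I\<close> and \<open>A\<^sub>I\<^sub>I\<close>. Values at types outside \<^term>\<open>gtypes A B\<close> are
  unconstrained.
\<close>

definition gauge_data ::
  "complex poly \<Rightarrow> complex poly \<Rightarrow> (gtype \<Rightarrow> ratfun) \<Rightarrow> (gtype \<Rightarrow> complex poly) \<Rightarrow> bool" where
  "gauge_data A B \<eta> Ag \<longleftrightarrow>
     \<eta> Empty = 0 \<and> Ag Empty = 1 \<and>
     (B \<noteq> pderiv A \<longrightarrow> \<eta> III = Fract (pderiv A - B) A \<and> Ag III = A) \<and>
     ((\<exists>a0 a1 a2. case1 A B a0 a1 a2) \<longrightarrow>
       (\<exists>a0 a1 a2. case1 A B a0 a1 a2 \<and>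
          \<eta> I = Fract [:poly (pderiv A) a1 - poly B a1:]
                      (smult (poly (pderiv A) a1) [:-a1, 1:]) \<and>
          \<eta> II = Fract [:poly (pderiv A) a2 - poly B a2:]
                       (smult (poly (pderiv A) a2) [:-a2, 1:]) \<and>
          (\<exists>c1 c2. c1 \<noteq> 0 \<and> c2 \<noteq> 0 \<and>
             Ag I = smult c1 [:-a1, 1:] \<and> Ag II = smult c2 [:-a2, 1:] \<and> Ag I * Ag II = A))) \<and>
     (\<forall>a0 a1. case2 A B a0 a1 \<longrightarrow>
        \<eta> I = Fract [:a0 - poly B a1:] (smult a0 [:-a1, 1:]) \<and> Ag I = A \<and>
        \<eta> II = Fract (- pderiv B) [:a0:] \<and> Ag II = 1)"

text \<open>
  The conjugate \<open>\<xi>\<^sup>-\<^sup>1 \<circ> (A \<partial>\<^sup>2 + B \<partial>) \<circ> \<xi>\<close>, where \<open>e = \<xi>' / \<xi>\<close>, acting on polynomials.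
  For the gauge data above the order-zero coefficient \<open>gauge_const\<close> is a constant.
\<close>

definition gauge_const :: "complex poly \<Rightarrow> complex poly \<Rightarrow> ratfun \<Rightarrow> ratfun" where
  "gauge_const A B e = to_fract A * (rderiv e + e\<^sup>2) + to_fract B * e"

definition gauge_op :: "complex poly \<Rightarrow> complex poly \<Rightarrow> ratfun \<Rightarrow> complex poly \<Rightarrow> ratfun" where
  "gauge_op A B e p =
     to_fract A * to_fract (pderiv (pderiv p))
     + (to_fract B + 2 * to_fract A * e) * to_fract (pderiv p)
     + gauge_const A B e * to_fract p"

definition eigenpoly :: "complex poly \<Rightarrow> complex poly \<Rightarrow> ratfun \<Rightarrow> nat \<Rightarrow> complex poly" where
  "eigenpoly A B e n =
     (THE p. degree p = n \<and> lead_coeff p = 1 \<and>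
        (\<exists>\<mu>. gauge_op A B e p = to_fract (smult \<mu> p)))"

definition eigenval :: "complex poly \<Rightarrow> complex poly \<Rightarrow> ratfun \<Rightarrow> nat \<Rightarrow> complex" where
  "eigenval A B e n =
     (THE \<mu>. gauge_op A B e (eigenpoly A B e n) = to_fract (smult \<mu> (eigenpoly A B e n)))"

text \<open>
  \<open>A\<^sub>\<rho> (p P' - (e p + p') P)\<close> as a polynomial (the product \<open>A\<^sub>\<rho> e\<close> is a polynomial for the
  gauge data above).
\<close>

definition darboux :: "complex poly \<Rightarrow> ratfun \<Rightarrow> complex poly \<Rightarrow> complex poly \<Rightarrow> complex poly" where
  "darboux Ar e p P =
     (THE q. to_fract q =
        to_fract Ar * (to_fract (p * pderiv P) - (e * to_fract p + to_fract (pderiv p)) * to_fract P))"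

text \<open>
  The exceptional polynomial of type \<open>\<rho>\<close> with integer index \<open>n\<close>. For type \<open>III\<close> the polynomial of
  index \<open>0\<close> is only determined up to a nonzero factor, which is the parameter \<open>\<kappa>\<close>.
\<close>

definition exc_poly ::
  "complex poly \<Rightarrow> complex poly \<Rightarrow> (gtype \<Rightarrow> ratfun) \<Rightarrow> (gtype \<Rightarrow> complex poly) \<Rightarrow> complex \<Rightarrow>
   gtype \<Rightarrow> nat \<Rightarrow> int \<Rightarrow> complex poly" where
  "exc_poly A B \<eta> Ag \<kappa> \<rho> j n =
     (let p = eigenpoly A B (\<eta> \<rho>) j; P = eigenpoly A B (\<eta> Empty) in
      if n < 0 then 0
      else if \<rho> = III then
        (if n = 0 then [:\<kappa>:]
         else if n \<le> int j then 0
         else darboux (Ag \<rho>) (\<eta> \<rho>) p (P (nat n - j - 1)))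
      else darboux (Ag \<rho>) (\<eta> \<rho>) p (P (nat n)))"

definition exc_index ::
  "complex poly \<Rightarrow> complex poly \<Rightarrow> (gtype \<Rightarrow> ratfun) \<Rightarrow> (gtype \<Rightarrow> complex poly) \<Rightarrow> complex \<Rightarrow>
   gtype \<Rightarrow> nat \<Rightarrow> nat set" where
  "exc_index A B \<eta> Ag \<kappa> \<rho> j = {n. exc_poly A B \<eta> Ag \<kappa> \<rho> j (int n) \<noteq> 0}"

definition S1 :: "complex poly \<Rightarrow> complex poly \<Rightarrow> (gtype \<Rightarrow> ratfun) \<Rightarrow> bool" where
  "S1 A B \<eta> \<longleftrightarrow>
     (\<forall>\<gamma>\<in>gtypes A B. \<forall>n::nat.
        to_fract (smult (of_nat n / 2) (pderiv (pderiv A))) + to_fract (pderiv B)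
        + 2 * rderiv (to_fract A * \<eta> \<gamma>) \<noteq> 0)"

definition S2 :: "complex poly \<Rightarrow> complex poly \<Rightarrow> (gtype \<Rightarrow> ratfun) \<Rightarrow> bool" where
  "S2 A B \<eta> \<longleftrightarrow> inj_on (\<lambda>(\<gamma>, n). eigenval A B (\<eta> \<gamma>) n) (gtypes A B \<times> UNIV)"

text \<open>
  The interval \<open>D\<close> is given by its endpoints \<open>a < b\<close> in the extended reals. All integrals over \<open>D\<close>
  are Henstock-Kurzweil integrals, which cover both absolutely convergent and improper ones.
\<close>

definition weight_eq ::
  "complex poly \<Rightarrow> complex poly \<Rightarrow> ereal \<Rightarrow> ereal \<Rightarrow> (real \<Rightarrow> complex) \<Rightarrow> bool" where
  "weight_eq A B a b w \<longleftrightarrow>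
     (\<forall>x\<in>einterval a b.
        ((\<lambda>t. poly A (of_real t) * w t) has_vector_derivative poly B (of_real x) * w x) (at x))"

definition S3 ::
  "complex poly \<Rightarrow> complex poly \<Rightarrow> (gtype \<Rightarrow> ratfun) \<Rightarrow> ereal \<Rightarrow> ereal \<Rightarrow> (real \<Rightarrow> complex) \<Rightarrow> bool"
  where
  "S3 A B \<eta> a b w \<longleftrightarrow>
     (((\<lambda>x. poly A (of_real x) * w x) \<circ> real_of_ereal) \<longlongrightarrow> 0) (at_right a) \<and>
     (((\<lambda>x. poly A (of_real x) * w x) \<circ> real_of_ereal) \<longlongrightarrow> 0) (at_left b) \<and>
     (\<exists>h :: nat \<Rightarrow> complex. (\<forall>n. h n \<noteq> 0) \<and>
        (\<forall>m n. ((\<lambda>x. poly (eigenpoly A B (\<eta> Empty) m) (of_real x) *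
                      poly (eigenpoly A B (\<eta> Empty) n) (of_real x) * w x)
                 has_integral (if m = n then h n else 0)) (einterval a b)))"

definition S4 ::
  "complex poly \<Rightarrow> complex poly \<Rightarrow> (gtype \<Rightarrow> ratfun) \<Rightarrow> (gtype \<Rightarrow> complex poly) \<Rightarrow> complex \<Rightarrow>
   ereal \<Rightarrow> ereal \<Rightarrow> (real \<Rightarrow> complex) \<Rightarrow> gtype \<Rightarrow> nat \<Rightarrow> bool" where
  "S4 A B \<eta> Ag \<kappa> a b w \<rho> j \<longleftrightarrow>
     (\<exists>h :: nat \<Rightarrow> complex. (\<forall>n\<in>exc_index A B \<eta> Ag \<kappa> \<rho> j. h n \<noteq> 0) \<and>
        (\<forall>n\<in>exc_index A B \<eta> Ag \<kappa> \<rho> j. \<forall>m\<in>exc_index A B \<eta> Ag \<kappa> \<rho> j.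
           ((\<lambda>x. poly (exc_poly A B \<eta> Ag \<kappa> \<rho> j (int n)) (of_real x) *
                 poly (exc_poly A B \<eta> Ag \<kappa> \<rho> j (int m)) (of_real x) *
                 (poly A (of_real x) * w x /
                  (poly (Ag \<rho>) (of_real x) * poly (eigenpoly A B (\<eta> \<rho>) j) (of_real x))\<^sup>2))
            has_integral (if n = m then h n else 0)) (einterval a b)))"

end

theory Submission
  imports Defs
begin

text \<open>
  The Darboux operator \<open>F[P] = A\<^sub>\<rho> (p P' - (\<eta> p + p') P)\<close> has a partner \<open>N\<close>, of first order with
  polynomial coefficients, such that \<open>N[F[P]] = p (L - \<mu>)[P]\<close>. Hence all exceptional polynomials lie
  in \<open>U = {y. p dvd N[y]}\<close>, and since \<open>I' = p\<close> the Leibniz rule shows \<open>I U \<subseteq> U\<close>. Conversely,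
  \<open>L - \<mu>\<close> is bijective on polynomials by (S2), so every \<open>y \<in> U\<close> is \<open>F[r]\<close> up to the kernel of \<open>N\<close>,
  which consists of the constants for type III and is trivial for types I and II. Counting degrees
  expands \<open>I\<close> times the \<open>n\<close>-th exceptional polynomial up to index \<open>n + j + 1\<close>, and the
  orthogonality (S4) with the symmetry of multiplication by \<open>I\<close> cuts it off below \<open>n - j - 1\<close>.
\<close>

section \<open>Second-order operators on polynomials and their eigenpolynomials\<close>

text \<open>Every conjugated operator takes this form once its denominators cancel;
  \<open>C = B\<close> and \<open>c = 0\<close> give L itself.\<close>

definition second_order_op ::
  "complex poly \<Rightarrow> complex poly \<Rightarrow> complex \<Rightarrow> complex poly \<Rightarrow> complex poly" where
  "second_order_op A C c p = A * pderiv (pderiv p) + C * pderiv p + smult c p"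

text \<open>The diagonal entry at x^n of the operator in the monomial basis, where it is upper
  triangular if \<open>degree A \<le> 2\<close> and \<open>degree C \<le> 1\<close>.\<close>

definition second_order_eigenvalue ::
  "complex poly \<Rightarrow> complex poly \<Rightarrow> complex \<Rightarrow> nat \<Rightarrow> complex" where
  "second_order_eigenvalue A C c n =
     of_nat n * (of_nat n - 1) * coeff A 2 + of_nat n * coeff C 1 + c"

lemma second_order_op_add:
  "second_order_op A C c (p + q) = second_order_op A C c p + second_order_op A C c q"
  by (simp add: second_order_op_def pderiv_add smult_add_right algebra_simps)

lemma second_order_op_diff:
  "second_order_op A C c (p - q) = second_order_op A C c p - second_order_op A C c q"
  by (simp add: second_order_op_def pderiv_diff smult_diff_right algebra_simps)

lemma linear_poly_eq:
  assumes "degree p \<le> 1"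
  shows "p = [:coeff p 0, coeff p 1:]"
  using assms by (intro poly_eqI) (auto simp: coeff_pCons coeff_eq_0 split: nat.split)

lemma coeff_second_order_op:
  assumes A: "degree A \<le> 2" and C: "degree C \<le> 1" and p: "degree p \<le> n"
  shows "coeff (second_order_op A C c p) n = second_order_eigenvalue A C c n * coeff p n"
proof -
  have A': "A = [:coeff A 0, coeff A 1, coeff A 2:]"
    using A by (intro poly_eqI) (auto simp: coeff_pCons coeff_eq_0 numeral_2_eq_2 split: nat.split)
  note C' = linear_poly_eq[OF C]
  have p0: "coeff p (Suc n) = 0" "coeff p (Suc (Suc n)) = 0"
    using p by (simp_all add: coeff_eq_0)
  show ?thesis
    unfolding second_order_op_def second_order_eigenvalue_def
    by (subst A', subst C', cases n rule: old.nat.exhaust; cases "n - 1")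
      (use p0 in \<open>simp_all add: coeff_pderiv algebra_simps coeff_pCons split: nat.split\<close>)
qed

lemma degree_second_order_op:
  assumes A: "degree A \<le> 2" and C: "degree C \<le> 1"
  shows "degree (second_order_op A C c p) \<le> degree p"
proof (rule degree_le, intro allI impI)
  fix i assume "degree p < i"
  then show "coeff (second_order_op A C c p) i = 0"
    using coeff_second_order_op[OF A C, of p i c] by (simp add: coeff_eq_0)
qed

text \<open>Back substitution in a triangular system whose diagonal entries below \<open>m\<close>
  avoid \<open>\<nu>\<close>. Size is measured by vanishing coefficients instead of
  \<open>degree\<close>, so that \<open>m = 0\<close> stands for the zero polynomial.\<close>

lemma second_order_op_solvable:
  assumes A: "degree A \<le> 2" and C: "degree C \<le> 1"
    and nonres: "\<And>k. k < m \<Longrightarrow> second_order_eigenvalue A C c k \<noteq> \<nu>"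
    and q: "\<And>i. m \<le> i \<Longrightarrow> coeff q i = 0"
  shows "\<exists>r. (\<forall>i\<ge>m. coeff r i = 0) \<and> second_order_op A C c r - smult \<nu> r = q"
  using nonres q
proof (induction m arbitrary: q)
  case 0
  then have "q = 0" by (intro poly_eqI) simp
  then show ?case by (intro exI[of _ 0]) (simp add: second_order_op_def)
next
  case (Suc m)
  \<comment> \<open>The monomial that accounts for coefficient \<open>m\<close> of \<open>q\<close>;
    the remainder \<open>q'\<close> is one size smaller.\<close>
  define t where "t = monom (coeff q m / (second_order_eigenvalue A C c m - \<nu>)) m"
  have t: "degree t \<le> m" "coeff t m * (second_order_eigenvalue A C c m - \<nu>) = coeff q m"
    using Suc.prems(1)[of m] by (auto simp: t_def degree_monom_le)
  define q' where "q' = q - (second_order_op A C c t - smult \<nu> t)"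
  have "coeff q' i = 0" if "m \<le> i" for i
  proof (cases "i = m")
    case True
    show ?thesis
      using t(2) by (simp add: True q'_def coeff_second_order_op[OF A C t(1)] algebra_simps)
  next
    case False
    then have "coeff q i = 0" "degree t < i" using Suc.prems(2)[of i] that t(1) by auto
    then show ?thesis
      using degree_second_order_op[OF A C, of c t] by (simp add: q'_def coeff_eq_0)
  qed
  with Suc.IH[of q'] Suc.prems(1) obtain r
    where r: "\<forall>i\<ge>m. coeff r i = 0" "second_order_op A C c r - smult \<nu> r = q'" by auto
  show ?case
  proof (intro exI[of _ "r + t"] conjI allI impI)
    fix i assume "Suc m \<le> i"
    then show "coeff (r + t) i = 0" using r(1) t(1) by (simp add: coeff_eq_0)
  next
    show "second_order_op A C c (r + t) - smult \<nu> (r + t) = q"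
      using r(2) by (simp add: second_order_op_add smult_add_right q'_def algebra_simps)
  qed
qed

text \<open>The leading coefficient of \<open>r\<close> is multiplied by its eigenvalue minus
  \<open>\<nu>\<close>, which is nonzero, so it survives.\<close>

lemma degree_second_order_op_nonresonant:
  assumes A: "degree A \<le> 2" and C: "degree C \<le> 1"
    and nonres: "second_order_eigenvalue A C c (degree r) \<noteq> \<nu>" and "r \<noteq> 0"
  shows "second_order_op A C c r - smult \<nu> r \<noteq> 0"
    and "degree (second_order_op A C c r - smult \<nu> r) = degree r"
proof -
  have c: "coeff (second_order_op A C c r - smult \<nu> r) (degree r) \<noteq> 0"
    using nonres \<open>r \<noteq> 0\<close> by (simp add: coeff_second_order_op[OF A C] left_diff_distrib[symmetric])
  then show "second_order_op A C c r - smult \<nu> r \<noteq> 0" by auto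
  show "degree (second_order_op A C c r - smult \<nu> r) = degree r"
  proof (rule antisym)
    show "degree (second_order_op A C c r - smult \<nu> r) \<le> degree r"
      by (intro degree_diff_le degree_second_order_op[OF A C]) simp
  qed (rule le_degree[OF c])
qed

lemma second_order_eigenvalue_unique:
  assumes A: "degree A \<le> 2" and C: "degree C \<le> 1"
    and eq: "second_order_op A C c p = smult \<mu> p" and "p \<noteq> 0"
  shows "\<mu> = second_order_eigenvalue A C c (degree p)"
  using degree_second_order_op_nonresonant(1)[OF A C _ \<open>p \<noteq> 0\<close>, of c \<mu>] eq by auto

text \<open>The difference of the two values factors as (m - n) ((m + n - 1) u + v), with u the
  coefficient of x^2 in \<open>A\<close> and v that of x in \<open>C\<close>. The hypothesis
  \<open>nz\<close>, which is (S1) in polynomial form, keeps the second factor away from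
  zero.\<close>

lemma second_order_eigenvalue_inj:
  assumes A: "degree A \<le> 2" and C: "degree C \<le> 1"
    and nz: "\<And>n. smult (of_nat n / 2) (pderiv (pderiv A)) + pderiv C \<noteq> 0"
    and "second_order_eigenvalue A C c m = second_order_eigenvalue A C c n"
  shows "m = n"
proof (rule ccontr)
  assume "m \<noteq> n"
  have key: "of_nat k * coeff A 2 + coeff C 1 \<noteq> 0" for k
  proof
    assume "of_nat k * coeff A 2 + coeff C 1 = 0"
    then have "coeff (smult (of_nat k / 2) (pderiv (pderiv A)) + pderiv C) i = 0" for i
      using A C by (cases i) (simp_all add: coeff_pderiv coeff_eq_0 numeral_2_eq_2)
    then have "smult (of_nat k / 2) (pderiv (pderiv A)) + pderiv C = 0"
      by (intro poly_eqI) simp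
    with nz show False by blast
  qed
  \<comment> \<open>Distinct \<open>m\<close> and \<open>n\<close> have a positive sum, so the
    subtraction in \<open>m + n - 1\<close> does not truncate.\<close>
  from \<open>m \<noteq> n\<close> have "Suc (m + n - 1) = m + n" by linarith
  then have e: "(of_nat (m + n - 1) :: complex) = of_nat m + of_nat n - 1"
    by (metis add_diff_cancel_left' of_nat_Suc of_nat_add)
  have "(of_nat m - of_nat n) * (of_nat (m + n - 1) * coeff A 2 + coeff C 1) = 0"
    using assms(4) unfolding e second_order_eigenvalue_def by (simp add: algebra_simps)
  with key[of "m + n - 1"] \<open>m \<noteq> n\<close> show False by simp
qed

text \<open>Existence: the correction of x^n by lower terms solves a triangular system, since no
  smaller index shares the eigenvalue. Uniqueness: two monic solutions would differ by an
  eigenvector of lower degree with the same eigenvalue.\<close>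

lemma second_order_eigenpoly_ex1:
  assumes A: "degree A \<le> 2" and C: "degree C \<le> 1"
    and nz: "\<And>n. smult (of_nat n / 2) (pderiv (pderiv A)) + pderiv C \<noteq> 0"
  shows "\<exists>!p. degree p = n \<and> lead_coeff p = 1 \<and> (\<exists>\<mu>. second_order_op A C c p = smult \<mu> p)"
proof -
  let ?T = "second_order_op A C c" and ?\<theta> = "second_order_eigenvalue A C c n"
  let ?x = "monom 1 n :: complex poly"
  have x: "degree ?x = n" "coeff ?x n = 1" by (simp_all add: degree_monom_eq)
  have inj: "second_order_eigenvalue A C c k \<noteq> ?\<theta>" if "k < n" for k
    using second_order_eigenvalue_inj[OF A C nz, of c k n] that by auto
  have "coeff (smult ?\<theta> ?x - ?T ?x) i = 0" if "n \<le> i" for i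
    using that coeff_second_order_op[OF A C, of ?x i c] x
    by (cases "i = n") (auto simp: coeff_eq_0)
  from second_order_op_solvable[OF A C inj this] obtain r
    where r: "\<forall>i\<ge>n. coeff r i = 0" "?T r - smult ?\<theta> r = smult ?\<theta> ?x - ?T ?x" by blast
  have c: "coeff (?x + r) n = 1" using x r(1) by simp
  have d: "degree (?x + r) = n"
  proof (rule antisym)
    show "degree (?x + r) \<le> n" using x r(1) by (intro degree_le) (auto simp: coeff_eq_0)
    show "n \<le> degree (?x + r)" using c by (intro le_degree) simp
  qed
  have e: "?T (?x + r) = smult ?\<theta> (?x + r)"
    using r(2) by (simp add: second_order_op_add smult_add_right algebra_simps)
  show ?thesis
  proof (rule ex1I[of _ "?x + r"])
    show "degree (?x + r) = n \<and> lead_coeff (?x + r) = 1 \<and> (\<exists>\<mu>. ?T (?x + r) = smult \<mu> (?x + r))"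
      using c d e by auto
  next
    fix p assume p: "degree p = n \<and> lead_coeff p = 1 \<and> (\<exists>\<mu>. ?T p = smult \<mu> p)"
    then have Tp: "?T p = smult ?\<theta> p" using second_order_eigenvalue_unique[OF A C] by fastforce
    show "p = ?x + r"
    proof (rule ccontr)
      assume ne: "p \<noteq> ?x + r"
      have "?T (p - (?x + r)) = smult ?\<theta> (p - (?x + r))"
        by (simp only: second_order_op_diff Tp e smult_diff_right)
      from second_order_eigenvalue_unique[OF A C this] ne
      have "?\<theta> = second_order_eigenvalue A C c (degree (p - (?x + r)))" by simp
      then have n: "degree (p - (?x + r)) = n" using second_order_eigenvalue_inj[OF A C nz] by metis
      have "coeff (p - (?x + r)) n = 0" using p c by auto
      with n ne show False by (metis eq_iff_diff_eq_0 leading_coeff_0_iff)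
    qed
  qed
qed

lemma
  assumes A: "degree A \<le> 2" and C: "degree C \<le> 1"
    and nz: "\<And>n. smult (of_nat n / 2) (pderiv (pderiv A)) + pderiv C \<noteq> 0"
    and op: "\<And>p. gauge_op A B e p = to_fract (second_order_op A C c p)"
  shows degree_eigenpoly: "degree (eigenpoly A B e n) = n"
    and lead_coeff_eigenpoly: "lead_coeff (eigenpoly A B e n) = 1"
    and second_order_op_eigenpoly:
      "second_order_op A C c (eigenpoly A B e n) = smult (eigenval A B e n) (eigenpoly A B e n)"
    and eigenval_eq: "eigenval A B e n = second_order_eigenvalue A C c n"
proof -
  let ?p = "eigenpoly A B e n"
  have eq: "?p = (THE p. degree p = n \<and> lead_coeff p = 1 \<and> (\<exists>\<mu>. second_order_op A C c p = smult \<mu> p))"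
    by (simp only: eigenpoly_def op to_fract_eq_iff)
  have p: "degree ?p = n \<and> lead_coeff ?p = 1 \<and> (\<exists>\<mu>. second_order_op A C c ?p = smult \<mu> ?p)"
    unfolding eq by (rule theI'[OF second_order_eigenpoly_ex1[OF A C nz]])
  then show d: "degree ?p = n" and l: "lead_coeff ?p = 1" by auto
  then have nz: "?p \<noteq> 0" by auto
  from p obtain \<mu> where \<mu>: "second_order_op A C c ?p = smult \<mu> ?p" by blast
  have "\<nu> = \<mu>" if "smult \<mu> ?p = smult \<nu> ?p" for \<nu>
    using arg_cong[OF that, of "\<lambda>q. coeff q n"] l d by simp
  then have "eigenval A B e n = \<mu>"
    unfolding eigenval_def op \<mu> by (intro the_equality) auto
  with \<mu> show e: "second_order_op A C c ?p = smult (eigenval A B e n) ?p" by simp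
  from second_order_eigenvalue_unique[OF A C e nz] d
  show "eigenval A B e n = second_order_eigenvalue A C c n" by simp
qed

section \<open>Gauge conjugation with polynomial coefficients\<close>

lemma rderiv_to_fract: "rderiv (to_fract p) = to_fract (pderiv p)"
  using rderiv_Fract[of 1 p] by (simp add: to_fract_def)

lemma to_fract_gauge:
  assumes "A = Ar * Ap" and "Ar \<noteq> 0"
  shows "to_fract A * Fract E Ar = to_fract (Ap * E)"
  using assms by (simp add: to_fract_def eq_fract)

text \<open>For \<eta> = E / Ar the decomposition of \<open>B\<close> makes the poles of A (\<eta>'
  + \<eta>^2) and B \<eta> at the zeros of \<open>Ar\<close> cancel. What remains is
  \<open>Ap * pderiv E + s * E\<close>, the constant of the conjugated operator.\<close>

lemma gauge_op_eq:
  assumes "Ar \<noteq> 0" and A: "A = Ar * Ap"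
    and B: "B = Ap * pderiv Ar + s * Ar - Ap * E"
    and c: "Ap * pderiv E + s * E = [:c:]"
  shows "gauge_op A B (Fract E Ar) p = to_fract (second_order_op A (B + 2 * Ap * E) c p)"
proof -
  \<comment> \<open>A pure field identity: \<open>r'\<close> and \<open>e'\<close> are free symbols
    for the derivatives of \<open>Ar\<close> and \<open>E\<close>.\<close>
  have id: "r * a * ((e' * r - e * r') / (r * r) + (e / r)\<^sup>2) + (a * r' + s * r - a * e) * (e / r)
      = a * e' + s * e" if "r \<noteq> 0" for r a r' e e' s :: ratfun
    using that by (simp add: field_simps power2_eq_square)
  have "gauge_const A B (Fract E Ar) = to_fract (Ap * pderiv E + s * E)"
    unfolding gauge_const_def rderiv_Fract[OF \<open>Ar \<noteq> 0\<close>]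
    unfolding A B Fract_conv_to_fract to_fract_add to_fract_diff to_fract_mult
    using \<open>Ar \<noteq> 0\<close> by (intro id) simp
  then have "gauge_const A B (Fract E Ar) * to_fract p = to_fract ([:c:] * p)"
    by (simp only: c to_fract_mult)
  moreover have "to_fract B + 2 * to_fract A * Fract E Ar = to_fract (B + 2 * Ap * E)"
    by (simp only: mult_2 distrib_right to_fract_gauge[OF A \<open>Ar \<noteq> 0\<close>] to_fract_add)
  ultimately show ?thesis
    by (simp add: gauge_op_def second_order_op_def)
qed

section \<open>The Darboux operator and its first-order partner\<close>

definition darboux_poly ::
  "complex poly \<Rightarrow> complex poly \<Rightarrow> complex poly \<Rightarrow> complex poly \<Rightarrow> complex poly" where
  "darboux_poly Ar E p P = Ar * (p * pderiv P - pderiv p * P) - E * p * P"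

lemma darboux_eq:
  assumes "Ar \<noteq> 0"
  shows "darboux Ar (Fract E Ar) p P = darboux_poly Ar E p P"
proof -
  have "to_fract (darboux_poly Ar E p P) =
      to_fract Ar * (to_fract (p * pderiv P) - (Fract E Ar * to_fract p + to_fract (pderiv p)) * to_fract P)"
    using assms by (simp add: darboux_poly_def Fract_conv_to_fract field_simps)
  from this[symmetric] show ?thesis
    unfolding darboux_def by simp
qed

lemma darboux_poly_add: "darboux_poly Ar E p (P + Q) = darboux_poly Ar E p P + darboux_poly Ar E p Q"
  by (simp add: darboux_poly_def pderiv_add algebra_simps)

lemma darboux_poly_smult: "darboux_poly Ar E p (smult k P) = smult k (darboux_poly Ar E p P)"
  by (simp add: darboux_poly_def pderiv_smult smult_diff_right right_diff_distrib)

lemma darboux_poly_sum: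
  "darboux_poly Ar E p (\<Sum>i\<in>K. f i) = (\<Sum>i\<in>K. darboux_poly Ar E p (f i))"
  using darboux_poly_smult[of Ar E p 0]
  by (induction K rule: infinite_finite_induct) (simp_all add: darboux_poly_add)

text \<open>The partner N. It depends on the splitting of \<open>A\<close> and \<open>B\<close>
  alone, not on the eigenpolynomial \<open>p\<close>.\<close>

definition dual_darboux ::
  "complex poly \<Rightarrow> complex poly \<Rightarrow> complex poly \<Rightarrow> complex poly" where
  "dual_darboux Ap s y = Ap * pderiv y + s * y"

lemma dual_darboux_diff: "dual_darboux Ap s (x - y) = dual_darboux Ap s x - dual_darboux Ap s y"
  by (simp add: dual_darboux_def pderiv_diff algebra_simps)

text \<open>For \<open>f\<close> an antiderivative of \<open>p\<close> the extra term is a multiple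
  of \<open>p\<close>, so divisibility of N[y] by \<open>p\<close> passes to N[f y].\<close>

lemma dual_darboux_mult: "dual_darboux Ap s (f * y) = f * dual_darboux Ap s y + Ap * pderiv f * y"
  by (simp add: dual_darboux_def pderiv_mult algebra_simps)

text \<open>Once the constant in the eigenvalue equation of \<open>p\<close> is written as
  \<open>Ap * pderiv E + s * E\<close>, both sides expand to the same expression in the polynomials
  and their derivatives.\<close>

lemma dual_darboux_darboux_poly:
  assumes A: "A = Ar * Ap" and B: "B = Ap * pderiv Ar + s * Ar - Ap * E"
    and c: "Ap * pderiv E + s * E = [:c:]"
    and p: "second_order_op A (B + 2 * Ap * E) c p = smult \<mu> p"
  shows "dual_darboux Ap s (darboux_poly Ar E p P) = p * (second_order_op A B 0 P - smult \<mu> P)"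
proof -
  have \<mu>: "smult \<mu> p = A * pderiv (pderiv p) + (B + 2 * Ap * E) * pderiv p + (Ap * pderiv E + s * E) * p"
    using p unfolding c by (simp add: second_order_op_def)
  have "p * (second_order_op A B 0 P - smult \<mu> P) = p * second_order_op A B 0 P - smult \<mu> p * P"
    by (simp add: algebra_simps)
  then show ?thesis
    unfolding \<mu> by (simp add: A B darboux_poly_def dual_darboux_def second_order_op_def
        pderiv_mult pderiv_diff pderiv_add algebra_simps)
qed

text \<open>
  Here \<open>Ap * z\<close> solves \<open>Z' = \<eta> Z\<close> for the logarithmic derivative \<open>\<eta> = (Ap' - s) / Ap\<close> of the gauge
  factor complementary to \<open>E / Ar\<close>.
\<close>

lemma second_order_op_dual_darboux_kernel:
  assumes A: "A = Ar * Ap" and B: "B = Ap * pderiv Ar + s * Ar - Ap * E"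
    and z: "dual_darboux Ap s z = 0"
  shows "second_order_op A B 0 (Ap * z) =
    (Ar * pderiv (pderiv Ap - s) + (pderiv Ar - E) * (pderiv Ap - s)) * (Ap * z)"
proof -
  have z': "Ap * pderiv z = - s * z"
    using z by (simp add: dual_darboux_def eq_neg_iff_add_eq_0)
  define D where "D = pderiv Ap - s"
  have Z': "pderiv (Ap * z) = D * z"
    using z' by (simp add: D_def pderiv_mult algebra_simps)
  have "A * pderiv (pderiv (Ap * z)) = Ar * (Ap * pderiv D * z + D * (Ap * pderiv z))"
    unfolding Z' A by (simp add: pderiv_mult algebra_simps)
  then show ?thesis
    unfolding second_order_op_def Z' z' B D_def[symmetric]
    by (simp add: D_def[THEN eq_diff_eq[THEN iffD1], symmetric] algebra_simps)
qed

section \<open>Degree bounds for a factorised gauge\<close>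

text \<open>The data of one type, with \<eta> = E / Ar and complementary factor \<open>Ap\<close>.
  The number \<delta> is 0 for types I and II and 1 for type III: the Darboux operator raises
  degrees by at most \<open>degree p + \<delta>\<close>, and its partner lowers them by at least
  \<delta>.\<close>

locale gauge_split =
  fixes A B Ar Ap E s :: "complex poly" and c :: complex and \<delta> :: nat
  assumes A: "A = Ar * Ap" and B: "B = Ap * pderiv Ar + s * Ar - Ap * E"
    and c: "Ap * pderiv E + s * E = [:c:]"
    and nz: "Ar \<noteq> 0" "Ap \<noteq> 0"
    and degrees: "degree Ar \<le> 1 + \<delta>" "degree Ap + \<delta> \<le> 1" "degree E \<le> \<delta>"
      "s = 0 \<or> degree s + \<delta> = 0"
begin

lemma degree_A: "degree A \<le> 2"
  using degrees nz by (simp add: A degree_mult_eq)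

lemma degree_ApE: "degree (Ap * E) \<le> 1"
  using degrees degree_mult_le[of Ap E] by linarith

lemma degree_B: "degree B \<le> 1"
proof -
  have "degree (Ap * pderiv Ar) \<le> 1"
    using degrees degree_mult_le[of Ap "pderiv Ar"] degree_pderiv[of Ar] by linarith
  moreover have "degree (s * Ar) \<le> 1"
    using degrees degree_mult_le[of s Ar] by auto
  ultimately show ?thesis
    unfolding B by (intro degree_diff_le degree_add_le degree_ApE)
qed

lemma degree_C: "degree (B + 2 * Ap * E) \<le> 1"
  using degree_add_le[OF degree_B degree_add_le[OF degree_ApE degree_ApE]]
  by (simp add: mult_2 algebra_simps)

lemma degree_dual_darboux:
  assumes "dual_darboux Ap s y \<noteq> 0"
  shows "degree (dual_darboux Ap s y) + \<delta> \<le> degree y"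
proof (cases "pderiv y = 0")
  case True
  \<comment> \<open>For constant \<open>y\<close> the partner reduces to multiplication by
    \<open>s\<close>; a nonzero result needs \<open>s \<noteq> 0\<close>, which forces
    \<open>\<delta> = 0\<close>.\<close>
  with assms degrees have "\<delta> = 0" "degree s = 0" by (auto simp: dual_darboux_def)
  then show ?thesis using True degree_mult_le[of s y] by (simp add: dual_darboux_def)
next
  case False
  then have y: "degree y \<ge> 1" by (simp add: pderiv_eq_0_iff)
  have "degree (Ap * pderiv y) \<le> degree y - \<delta>"
    using degrees(2) y degree_mult_le[of Ap "pderiv y"] degree_pderiv[of y] by linarith
  moreover have "degree (s * y) \<le> degree y - \<delta>"
    using degrees(4) degree_mult_le[of s y] by auto
  ultimately have "degree (dual_darboux Ap s y) \<le> degree y - \<delta>"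
    unfolding dual_darboux_def by (rule degree_add_le)
  then show ?thesis using degrees(2) y by linarith
qed

text \<open>The Wronskian of \<open>p\<close> and \<open>P\<close> loses one degree and
  \<open>Ar\<close> adds at most \<open>1 + \<delta>\<close>. Two constants are treated apart: their
  Wronskian vanishes.\<close>

lemma degree_darboux_poly_le: "degree (darboux_poly Ar E p P) \<le> degree P + degree p + \<delta>"
proof -
  have "degree (Ar * (p * pderiv P - pderiv p * P)) \<le> degree P + degree p + \<delta>"
  proof (cases "degree P + degree p")
    case 0
    then have "pderiv P = 0" "pderiv p = 0" by (simp_all add: pderiv_eq_0_iff)
    then show ?thesis by simp
  next
    case (Suc d)
    have "degree (p * pderiv P) \<le> d"
    proof (cases "degree P = 0")
      case False
      then show ?thesis using Suc degree_mult_le[of p "pderiv P"] degree_pderiv[of P] by linarith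
    qed (simp add: pderiv_eq_0_iff[THEN iffD2])
    moreover have "degree (pderiv p * P) \<le> d"
    proof (cases "degree p = 0")
      case False
      then show ?thesis using Suc degree_mult_le[of "pderiv p" P] degree_pderiv[of p] by linarith
    qed (simp add: pderiv_eq_0_iff[THEN iffD2])
    ultimately have "degree (p * pderiv P - pderiv p * P) \<le> d" by (rule degree_diff_le)
    then show ?thesis
      using degrees(1) Suc degree_mult_le[of Ar "p * pderiv P - pderiv p * P"] by linarith
  qed
  moreover have "degree (E * p * P) \<le> degree P + degree p + \<delta>"
    using degrees(3) degree_mult_le[of E p] degree_mult_le[of "E * p" P] by linarith
  ultimately show ?thesis unfolding darboux_poly_def by (rule degree_diff_le)
qed

end

section \<open>Expansions in the image of the Darboux operator\<close>

lemma poly_expansion: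
  fixes P :: "nat \<Rightarrow> complex poly"
  assumes P: "\<And>k. degree (P k) = k" "\<And>k. P k \<noteq> 0" and r: "\<And>i. m \<le> i \<Longrightarrow> coeff r i = 0"
  obtains d where "r = (\<Sum>k<m. smult (d k) (P k))"
proof -
  have "\<exists>d. r = (\<Sum>k<m. smult (d k) (P k))"
    using r
  proof (induction m arbitrary: r)
    case 0
    then show ?case by (simp add: poly_eq_iff)
  next
    case (Suc m)
    define t where "t = coeff r m / coeff (P m) m"
    have "coeff (P m) m \<noteq> 0" using P[of m] by (metis leading_coeff_0_iff)
    then have "coeff (r - smult t (P m)) i = 0" if "m \<le> i" for i
      using Suc.prems[of i] that P(1)[of m] by (cases "i = m") (auto simp: t_def coeff_eq_0)
    with Suc.IH obtain d where "r - smult t (P m) = (\<Sum>k<m. smult (d k) (P k))" by blast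
    then have "r = (\<Sum>k<Suc m. smult ((d(m := t)) k) (P k))" by (simp add: algebra_simps)
    then show ?case by (intro exI[of _ "d(m := t)"])
  qed
  with that show thesis by blast
qed

context gauge_split
begin

context
  fixes p :: "complex poly" and \<mu> :: complex
  assumes p: "second_order_op A (B + 2 * Ap * E) c p = smult \<mu> p" "p \<noteq> 0"
    and nonres: "\<And>k. second_order_eigenvalue A B 0 k \<noteq> \<mu>"
begin

text \<open>The lower bound comes from the partner relation: \<open>\<mu>\<close> is no eigenvalue
  of L, so p (L - \<mu>)[r] has degree exactly \<open>degree p + degree r\<close>, and the partner
  has already removed at least \<delta> degrees.\<close>

lemma degree_darboux_poly:
  assumes "r \<noteq> 0"
  shows "darboux_poly Ar E p r \<noteq> 0"
    and "degree (darboux_poly Ar E p r) = degree r + degree p + \<delta>"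
proof -
  note L = degree_second_order_op_nonresonant[OF degree_A degree_B nonres \<open>r \<noteq> 0\<close>]
  note N = dual_darboux_darboux_poly[OF A B c p(1), of r]
  from L(1) p(2) have nz: "dual_darboux Ap s (darboux_poly Ar E p r) \<noteq> 0" unfolding N by simp
  then show "darboux_poly Ar E p r \<noteq> 0" by (auto simp: dual_darboux_def)
  have "degree p + degree r + \<delta> \<le> degree (darboux_poly Ar E p r)"
    using degree_dual_darboux[OF nz] unfolding N degree_mult_eq[OF p(2) L(1)] L(2) .
  with degree_darboux_poly_le[of p r]
  show "degree (darboux_poly Ar E p r) = degree r + degree p + \<delta>" by linarith
qed

text \<open>Solving (L - \<mu>)[r] = N[y] / p yields an \<open>r\<close> whose Darboux image has the
  same N-image as \<open>y\<close>.\<close>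

lemma darboux_poly_decomposition:
  assumes "p dvd dual_darboux Ap s y"
  obtains r where "dual_darboux Ap s (y - darboux_poly Ar E p r) = 0"
proof -
  from assms obtain q where q: "dual_darboux Ap s y = p * q" by blast
  have "coeff q i = 0" if "Suc (degree q) \<le> i" for i using that by (simp add: coeff_eq_0)
  from second_order_op_solvable[OF degree_A degree_B nonres this] obtain r
    where "second_order_op A B 0 r - smult \<mu> r = q" by blast
  then have "dual_darboux Ap s (y - darboux_poly Ar E p r) = 0"
    by (simp add: dual_darboux_diff dual_darboux_darboux_poly[OF A B c p(1)] q)
  with that show thesis .
qed

lemma darboux_poly_expansion:
  assumes y: "p dvd dual_darboux Ap s y" "degree y < m + degree p + \<delta>" and "0 < m"
    and ker: "\<And>z. dual_darboux Ap s z = 0 \<Longrightarrow> degree z = 0"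
    and P: "\<And>k. degree (P k) = k" "\<And>k. P k \<noteq> 0"
  obtains z d where "dual_darboux Ap s z = 0"
    and "y = z + (\<Sum>k<m. smult (d k) (darboux_poly Ar E p (P k)))"
proof -
  from darboux_poly_decomposition[OF y(1)] obtain r
    where r: "dual_darboux Ap s (y - darboux_poly Ar E p r) = 0" .
  define z where "z = y - darboux_poly Ar E p r"
  \<comment> \<open>The kernel element \<open>z\<close> is constant, and \<open>0 < m\<close> keeps
    constants under the bound. The exact degree formula then limits the degree of
    \<open>r\<close>.\<close>
  have "degree (darboux_poly Ar E p r) < m + degree p + \<delta>"
    using degree_diff_less[of y _ z] y(2) ker[OF r] \<open>0 < m\<close> by (simp add: z_def)
  then have "coeff r i = 0" if "m \<le> i" for i
    using that degree_darboux_poly(2)[of r] by (cases "r = 0") (auto simp: coeff_eq_0)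
  from poly_expansion[OF P this] obtain d where "r = (\<Sum>k<m. smult (d k) (P k))" .
  then have "darboux_poly Ar E p r = (\<Sum>k<m. smult (d k) (darboux_poly Ar E p (P k)))"
    by (simp add: darboux_poly_sum darboux_poly_smult)
  then have "y = z + (\<Sum>k<m. smult (d k) (darboux_poly Ar E p (P k)))" by (simp add: z_def)
  with r that show thesis unfolding z_def by blast
qed

end

end

section \<open>From orthogonality to a banded recurrence\<close>

text \<open>Multiplication by \<open>f\<close> is symmetric for the pairing with weight
  \<open>W\<close>. If \<open>m + N < n\<close>, then \<open>c m * h m\<close> is the pairing of
  \<open>f * Q n\<close> with \<open>Q m\<close>, hence of \<open>Q n\<close> with
  \<open>f * Q m\<close>, which expands only up to index \<open>m + N\<close> and so is orthogonal
  to \<open>Q n\<close>.\<close>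

lemma banded_recurrence:
  fixes Q :: "int \<Rightarrow> complex poly" and W :: "real \<Rightarrow> complex"
  assumes neg: "\<And>n. n < 0 \<Longrightarrow> Q n = 0"
    and up: "\<And>n. Q (int n) \<noteq> 0 \<Longrightarrow> \<exists>c. f * Q (int n) = (\<Sum>k\<le>n + N. smult (c k) (Q (int k)))"
    and orth: "\<And>m n. Q (int m) \<noteq> 0 \<Longrightarrow> Q (int n) \<noteq> 0 \<Longrightarrow>
      ((\<lambda>x. poly (Q (int m)) (of_real x) * poly (Q (int n)) (of_real x) * W x)
        has_integral (if m = n then h m else 0)) S"
    and h: "\<And>n. Q (int n) \<noteq> 0 \<Longrightarrow> h n \<noteq> 0"
    and n: "Q (int n) \<noteq> 0"
  shows "\<exists>\<beta>. f * Q (int n) = (\<Sum>l = - int N..int N. smult (\<beta> l) (Q (int n + l)))"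
proof -
  from up[OF n] obtain c where c: "f * Q (int n) = (\<Sum>k\<le>n + N. smult (c k) (Q (int k)))" by blast
  have pair: "((\<lambda>x. poly (f * Q (int k)) (of_real x) * poly (Q (int m)) (of_real x) * W x)
      has_integral (if m \<le> k + N then d m * h m else 0)) S"
    if m: "Q (int m) \<noteq> 0" and d: "f * Q (int k) = (\<Sum>i\<le>k + N. smult (d i) (Q (int i)))" for k m d
  proof -
    \<comment> \<open>If \<open>Q i\<close> vanishes, then \<open>i \<noteq> m\<close>, so the
      prescribed value 0 is still correct.\<close>
    have "((\<lambda>x. poly (Q (int i)) (of_real x) * poly (Q (int m)) (of_real x) * W x)
        has_integral (if i = m then h m else 0)) S" for i
      using orth[OF _ m, of i] m by (cases "Q (int i) = 0") (auto split: if_splits)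
    then have "((\<lambda>x. \<Sum>i\<le>k + N. d i * (poly (Q (int i)) (of_real x) * poly (Q (int m)) (of_real x) * W x))
        has_integral (\<Sum>i\<le>k + N. d i * (if i = m then h m else 0))) S"
      by (intro has_integral_sum has_integral_mult_right) auto
    then show ?thesis
      by (simp add: d poly_sum sum_distrib_right mult.assoc if_distrib[of "\<lambda>t. _ * t"] cong: if_cong)
  qed
  have low: "smult (c m) (Q (int m)) = 0" if "m + N < n" for m
  proof (cases "Q (int m) = 0")
    case False
    from up[OF this] obtain d where "f * Q (int m) = (\<Sum>k\<le>m + N. smult (d k) (Q (int k)))" by blast
    from pair[OF n this] that
    have "((\<lambda>x. poly (f * Q (int n)) (of_real x) * poly (Q (int m)) (of_real x) * W x) has_integral 0) S"
      by (simp add: mult_ac)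
    from has_integral_unique[OF this pair[OF False c]] that h[OF False] show ?thesis by simp
  qed simp
  have "f * Q (int n) = (\<Sum>k\<in>int ` {..n + N}. smult (c (nat k)) (Q k))"
    unfolding c by (simp add: sum.reindex)
  \<comment> \<open>Indices gained are negative, where \<open>Q\<close> vanishes; indices lost lie
    below \<open>n - N\<close>, where \<open>low\<close> applies.\<close>
  also have "\<dots> = (\<Sum>k = int n - int N..int n + int N. smult (c (nat k)) (Q k))"
  proof (rule sum.mono_neutral_cong)
    fix k assume "k \<in> {int n - int N..int n + int N} - int ` {..n + N}"
    then have "k < 0" by (cases k) (auto simp: image_iff)
    then show "smult (c (nat k)) (Q k) = 0" by (simp add: neg)
  next
    fix k assume "k \<in> int ` {..n + N} - {int n - int N..int n + int N}"
    then show "smult (c (nat k)) (Q k) = 0" using low[of "nat k"] by auto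
  qed auto
  also have "\<dots> = (\<Sum>l = - int N..int N. smult (c (nat (int n + l))) (Q (int n + l)))"
    by (rule sum.reindex_bij_witness[of _ "\<lambda>l. int n + l" "\<lambda>k. k - int n"]) auto
  finally show ?thesis by (intro exI[of _ "\<lambda>l. c (nat (int n + l))"])
qed

section \<open>Eigenpolynomials and factorisations attached to the types\<close>

text \<open>Since A \<eta> = Ap E, condition (S1) for the type is the nondegeneracy of the operator
  with first-order coefficient \<open>B + 2 * Ap * E\<close>.\<close>

lemma eigenpoly_facts:
  assumes S1: "S1 A B \<eta>" and \<gamma>: "\<gamma> \<in> gtypes A B" and \<eta>: "\<eta> \<gamma> = Fract E Ar"
    and Ar: "Ar \<noteq> 0" and A: "A = Ar * Ap" and B: "B = Ap * pderiv Ar + s * Ar - Ap * E"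
    and c: "Ap * pderiv E + s * E = [:c:]"
    and deg: "degree A \<le> 2" "degree (B + 2 * Ap * E) \<le> 1"
  shows "degree (eigenpoly A B (\<eta> \<gamma>) n) = n"
    and "eigenpoly A B (\<eta> \<gamma>) n \<noteq> 0"
    and "second_order_op A (B + 2 * Ap * E) c (eigenpoly A B (\<eta> \<gamma>) n) =
      smult (eigenval A B (\<eta> \<gamma>) n) (eigenpoly A B (\<eta> \<gamma>) n)"
    and "eigenval A B (\<eta> \<gamma>) n = second_order_eigenvalue A (B + 2 * Ap * E) c n"
proof -
  have nz: "smult (of_nat n / 2) (pderiv (pderiv A)) + pderiv (B + 2 * Ap * E) \<noteq> 0" for n
  proof -
    have "to_fract (smult (of_nat n / 2) (pderiv (pderiv A))) + to_fract (pderiv B)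
        + 2 * rderiv (to_fract A * \<eta> \<gamma>) \<noteq> 0"
      using S1 \<gamma> unfolding S1_def by blast
    also have "2 * rderiv (to_fract A * \<eta> \<gamma>) = to_fract (pderiv (2 * Ap * E))"
      unfolding \<eta> to_fract_gauge[OF A Ar] rderiv_to_fract
      by (simp only: mult_2 distrib_right pderiv_add to_fract_add)
    finally show ?thesis
      by (simp only: pderiv_add to_fract_add[symmetric] add.assoc) (metis to_fract_0)
  qed
  note op = gauge_op_eq[OF Ar A B c, folded \<eta>]
  show d: "degree (eigenpoly A B (\<eta> \<gamma>) n) = n"
    by (rule degree_eigenpoly[OF deg nz op])
  show "eigenpoly A B (\<eta> \<gamma>) n \<noteq> 0"
    using lead_coeff_eigenpoly[OF deg nz op, of n] by auto
  show "second_order_op A (B + 2 * Ap * E) c (eigenpoly A B (\<eta> \<gamma>) n) =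
      smult (eigenval A B (\<eta> \<gamma>) n) (eigenpoly A B (\<eta> \<gamma>) n)"
    by (rule second_order_op_eigenpoly[OF deg nz op])
  show "eigenval A B (\<eta> \<gamma>) n = second_order_eigenvalue A (B + 2 * Ap * E) c n"
    by (rule eigenval_eq[OF deg nz op])
qed

text \<open>Type \<open>Empty\<close> is the trivial splitting \<open>Ar = 1\<close>,
  \<open>Ap = A\<close>, \<open>E = 0\<close>, \<open>s = B\<close>, with constant 0.\<close>

lemma eigenpoly_facts_Empty:
  assumes S1: "S1 A B \<eta>" and \<eta>: "\<eta> Empty = 0" and deg: "degree A \<le> 2" "degree B \<le> 1"
  shows "degree (eigenpoly A B (\<eta> Empty) n) = n"
    and "eigenpoly A B (\<eta> Empty) n \<noteq> 0"
    and "eigenval A B (\<eta> Empty) n = second_order_eigenvalue A B 0 n"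
proof -
  have "Empty \<in> gtypes A B" by (simp add: gtypes_def)
  moreover have "\<eta> Empty = Fract 0 1" by (simp add: \<eta> fract_collapse)
  ultimately show "degree (eigenpoly A B (\<eta> Empty) n) = n" "eigenpoly A B (\<eta> Empty) n \<noteq> 0"
    "eigenval A B (\<eta> Empty) n = second_order_eigenvalue A B 0 n"
    using eigenpoly_facts[OF S1, of Empty 0 1 A B 0 n] deg by simp_all
qed

text \<open>The statement is symmetric in the two roots up to exchanging \<open>Ar\<close> and
  \<open>Ap\<close>, so it serves both type I and type II.\<close>

lemma gauge_split_case1:
  assumes A: "A = Ar * Ap" and Ar: "Ar = smult c1 [:-a1, 1:]" and Ap: "Ap = smult c2 [:-a2, 1:]"
    and nz: "c1 \<noteq> 0" "c2 \<noteq> 0" "a1 \<noteq> a2" and B: "degree B \<le> 1"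
  defines "d1 \<equiv> poly (pderiv A) a1" and "d2 \<equiv> poly (pderiv A) a2"
  shows "\<exists>E s c. gauge_split A B Ar Ap E s c 0
    \<and> Fract [:d1 - poly B a1:] (smult d1 [:-a1, 1:]) = Fract E Ar
    \<and> Fract [:d2 - poly B a2:] (smult d2 [:-a2, 1:]) = Fract (pderiv Ap - s) Ap"
proof -
  \<comment> \<open>As \<open>degree B \<le> 1\<close>, the decomposition of \<open>B\<close> is
    fixed by its values at the two roots: \<open>a1\<close> determines \<open>e\<close> and
    \<open>a2\<close> determines \<open>t\<close>.\<close>
  define e where "e = c1 * (1 - poly B a1 / d1)"
  define t where "t = c2 * poly B a2 / d2"
  have d: "d1 = c1 * c2 * (a1 - a2)" "d2 = c1 * c2 * (a2 - a1)"
    unfolding d1_def d2_def A Ar Ap by (simp_all add: pderiv_mult pderiv_smult pderiv_pCons algebra_simps)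
  have nz': "d1 \<noteq> 0" "d2 \<noteq> 0" using nz by (auto simp: d)
  obtain b0 b1 where b: "B = [:b0, b1:]" using linear_poly_eq[OF B] by blast
  have "a1 - a2 \<noteq> 0" "a2 - a1 \<noteq> 0" using nz by auto
  then have B': "B = Ap * pderiv Ar + [:t:] * Ar - Ap * [:e:]"
    using nz unfolding b Ar Ap e_def t_def d
    by (simp add: pderiv_smult pderiv_pCons divide_simps) algebra
  have "gauge_split A B Ar Ap [:e:] [:t:] (t * e) 0"
    using nz by unfold_locales (simp_all add: A B'[unfolded A] pderiv_pCons, simp_all add: Ar Ap)
  moreover have "Fract [:d1 - poly B a1:] (smult d1 [:-a1, 1:]) = Fract [:e:] Ar"
    using nz nz' by (simp add: eq_fract Ar e_def field_simps)
  moreover have "Fract [:d2 - poly B a2:] (smult d2 [:-a2, 1:]) = Fract (pderiv Ap - [:t:]) Ap"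
    using nz nz' by (simp add: eq_fract Ap t_def pderiv_smult pderiv_pCons field_simps)
  ultimately show ?thesis by blast
qed

abbreviation dual_type :: "gtype \<Rightarrow> gtype" where
  "dual_type \<rho> \<equiv> (if \<rho> = I then II else I)"

lemma gauge_split_I_II:
  assumes g: "gauge_data A B \<eta> Ag" and B: "degree B \<le> 1"
    and \<rho>: "\<rho> \<in> {I, II}" "\<rho> \<in> gtypes A B"
  shows "\<exists>Ap E s c. gauge_split A B (Ag \<rho>) Ap E s c 0 \<and> \<eta> \<rho> = Fract E (Ag \<rho>)
    \<and> \<eta> (dual_type \<rho>) = Fract (pderiv Ap - s) Ap"
proof (cases "\<exists>a0 a1 a2. case1 A B a0 a1 a2")
  case True
  with g obtain a0 a1 a2 c1 c2 where c1: "case1 A B a0 a1 a2"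
    and \<eta>: "\<eta> I = Fract [:poly (pderiv A) a1 - poly B a1:] (smult (poly (pderiv A) a1) [:-a1, 1:])"
      "\<eta> II = Fract [:poly (pderiv A) a2 - poly B a2:] (smult (poly (pderiv A) a2) [:-a2, 1:])"
    and c: "c1 \<noteq> 0" "c2 \<noteq> 0"
    and Ag: "Ag I = smult c1 [:-a1, 1:]" "Ag II = smult c2 [:-a2, 1:]" "A = Ag I * Ag II"
    unfolding gauge_data_def by metis
  have a: "a1 \<noteq> a2" using c1 by (simp add: case1_def)
  have A': "A = Ag II * Ag I" using Ag(3) by (simp add: mult.commute)
  from \<rho>(1) consider "\<rho> = I" | "\<rho> = II" by blast
  then show ?thesis
  proof cases
    case 1
    with gauge_split_case1[OF Ag(3,1,2) c a B] show ?thesis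
      unfolding \<eta>[symmetric] by simp blast
  next
    case 2
    with gauge_split_case1[OF A' Ag(2,1) c(2,1) a[symmetric] B] show ?thesis
      unfolding \<eta>[symmetric] by simp blast
  qed
next
  case False
  with \<rho> obtain a0 a1 where c2: "case2 A B a0 a1" by (auto simp: gtypes_def)
  with g have \<eta>: "\<eta> I = Fract [:a0 - poly B a1:] (smult a0 [:-a1, 1:])" "Ag I = A"
      "\<eta> II = Fract (- pderiv B) [:a0:]" "Ag II = 1"
    unfolding gauge_data_def by metis+
  from c2 have a0: "a0 \<noteq> 0" and A: "A = smult a0 [:-a1, 1:]" by (auto simp: case2_def)
  obtain b0 b1 where b: "B = [:b0, b1:]" using linear_poly_eq[OF B] by blast
  from \<rho>(1) consider "\<rho> = I" | "\<rho> = II" by blast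
  then show ?thesis
  proof cases
    case 1
    \<comment> \<open>Both splittings for linear \<open>A\<close> rest on the expansion B = B(a1) +
      (b1 / a0) A at the root; types I and II distribute its terms differently over \<open>E\<close>
      and \<open>s\<close>.\<close>
    have "gauge_split A B A 1 [:a0 - poly B a1:] [:b1 / a0:] (b1 / a0 * (a0 - poly B a1)) 0"
      using a0 by unfold_locales (simp_all add: A b pderiv_smult pderiv_pCons field_simps)
    moreover have "Fract (- pderiv B) [:a0:] = Fract (pderiv 1 - [:b1 / a0:]) 1"
      using a0 by (simp add: eq_fract b pderiv_pCons)
    ultimately show ?thesis
      using 1 \<eta> A
      by - (rule exI[of _ 1], rule exI[of _ "[:a0 - poly B a1:]"], rule exI[of _ "[:b1 / a0:]"], auto)
  next
    case 2
    have "gauge_split A B 1 A [:- b1 / a0:] [:poly B a1:] (poly B a1 * (- b1 / a0)) 0"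
      using a0 by unfold_locales (simp_all add: A b pderiv_smult pderiv_pCons field_simps)
    moreover have "Fract (- pderiv B) [:a0:] = Fract [:- b1 / a0:] 1"
      using a0 by (simp add: eq_fract b pderiv_pCons)
    moreover have "pderiv A = [:a0:]" by (simp add: A pderiv_smult pderiv_pCons)
    ultimately show ?thesis
      using 2 \<eta> A
      by - (rule exI[of _ A], rule exI[of _ "[:- b1 / a0:]"], rule exI[of _ "[:poly B a1:]"], auto)
  qed
qed

text \<open>With \<open>Ap = 1\<close> and \<open>s = 0\<close> the partner is plain
  differentiation, which explains \<open>\<delta> = 1\<close> and a kernel of constants.\<close>

lemma gauge_split_III:
  assumes "A \<noteq> 0" and deg: "degree A \<le> 2" "degree B \<le> 1"
  shows "gauge_split A B A 1 (pderiv A - B) 0 (coeff (pderiv (pderiv A - B)) 0) 1"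
proof -
  have E: "degree (pderiv A - B) \<le> 1"
    using deg degree_pderiv[of A] by (intro degree_diff_le) auto
  then have "degree (pderiv (pderiv A - B)) = 0" using degree_pderiv[of "pderiv A - B"] by simp
  then have "pderiv (pderiv A - B) = [:coeff (pderiv (pderiv A - B)) 0:]"
    by (metis degree_eq_zeroE coeff_pCons_0)
  with assms E show ?thesis by unfold_locales auto
qed

text \<open>
  A nonzero kernel element would make \<open>\<xi>\<close> of the complementary type a polynomial, hence the
  eigenvalue of index \<open>0\<close> of that type would also be one of type \<open>Empty\<close>, against (S2).
\<close>

lemma dual_darboux_injective_I_II:
  assumes "gauge_split A B Ar Ap E s c 0"
    and \<eta>: "\<eta> (dual_type \<rho>) = Fract (pderiv Ap - s) Ap" "\<eta> Empty = 0"
    and \<rho>: "\<rho> \<in> {I, II}" "\<rho> \<in> gtypes A B"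
    and S1: "S1 A B \<eta>" and S2: "S2 A B \<eta>"
    and z: "dual_darboux Ap s z = 0"
  shows "z = 0"
proof (rule ccontr)
  assume "z \<noteq> 0"
  interpret gauge_split A B Ar Ap E s c 0 by fact
  \<comment> \<open>The complementary type has the splitting with \<open>Ar\<close> and
    \<open>Ap\<close> exchanged, where \<open>D\<close> and \<open>t\<close> take the places of
    \<open>E\<close> and \<open>s\<close>.\<close>
  define D where "D = pderiv Ap - s"
  define t where "t = pderiv Ar - E"
  have "degree D = 0" "degree t = 0"
    using degrees degree_pderiv[of Ap] degree_pderiv[of Ar]
      degree_diff_le[of "pderiv Ap" 0 s] degree_diff_le[of "pderiv Ar" 0 E]
    by (auto simp: D_def t_def)
  then obtain d t' where d: "D = [:d:]" and t': "t = [:t':]"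
    by (metis degree_eq_zeroE)
  have c': "Ar * pderiv D + t * D = [:t' * d:]" by (simp add: d t')
  have A': "A = Ap * Ar" by (simp add: A mult.commute)
  have B': "B = Ar * pderiv Ap + t * Ap - Ar * D" by (simp add: B D_def t_def algebra_simps)
  have deg: "degree (B + 2 * Ar * D) \<le> 1"
  proof -
    have "degree (2 * Ar * D) \<le> degree Ar"
      using degree_mult_le[of "2 * Ar" D] degree_mult_le[of "2 :: complex poly" Ar]
      by (simp add: \<open>degree D = 0\<close>)
    then show ?thesis using degrees(1) by (intro degree_add_le degree_B) simp
  qed
  have dual: "dual_type \<rho> \<in> gtypes A B" using \<rho> by (auto simp: gtypes_def)
  have "eigenval A B (\<eta> (dual_type \<rho>)) 0 = t' * d"
    using eigenpoly_facts(4)[OF S1 dual \<eta>(1)[folded D_def] nz(2) A' B' c' degree_A deg, of 0]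
    by (simp add: second_order_eigenvalue_def)
  moreover have "second_order_op A B 0 (Ap * z) = smult (t' * d) (Ap * z)"
    using second_order_op_dual_darboux_kernel[OF A B z] c' by (simp add: D_def t_def)
  then have "t' * d = second_order_eigenvalue A B 0 (degree (Ap * z))"
    using second_order_eigenvalue_unique[OF degree_A degree_B] nz \<open>z \<noteq> 0\<close> by simp
  ultimately have "eigenval A B (\<eta> (dual_type \<rho>)) 0 = eigenval A B (\<eta> Empty) (degree (Ap * z))"
    using eigenpoly_facts_Empty(3)[where \<eta>=\<eta>, OF S1 \<eta>(2) degree_A degree_B] by simp
  with S2 dual show False
    unfolding S2_def by (auto dest!: inj_onD[where x = "(dual_type \<rho>, 0)"
        and y = "(Empty, degree (Ap * z))"] simp: gtypes_def split: if_splits)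
qed

section \<open>Upward expansion for each type\<close>

text \<open>The \<open>k\<close>-th exceptional polynomial has degree k + j, and the product with
  \<open>Ij\<close> has degree at most n + 2 j + 1, so indices up to n + j + 1 suffice. The trivial
  kernel of the partner leaves no remainder.\<close>

lemma exc_poly_expansion_I_II:
  assumes g: "gauge_data A B \<eta> Ag" and deg: "degree B \<le> 1"
    and \<rho>: "\<rho> \<in> {I, II}" "\<rho> \<in> gtypes A B" and S1: "S1 A B \<eta>" and S2: "S2 A B \<eta>"
    and Ij: "pderiv Ij = eigenpoly A B (\<eta> \<rho>) j"
  shows "\<exists>d. Ij * exc_poly A B \<eta> Ag \<kappa> \<rho> j (int n) =
    (\<Sum>k\<le>n + Suc j. smult (d k) (exc_poly A B \<eta> Ag \<kappa> \<rho> j (int k)))"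
proof -
  from gauge_split_I_II[OF g deg \<rho>] obtain Ap E s c
    where split: "gauge_split A B (Ag \<rho>) Ap E s c 0"
      and \<eta>: "\<eta> \<rho> = Fract E (Ag \<rho>)" "\<eta> (dual_type \<rho>) = Fract (pderiv Ap - s) Ap" by blast
  interpret gauge_split A B "Ag \<rho>" Ap E s c 0 by fact
  have \<eta>0: "\<eta> Empty = 0" using g by (simp add: gauge_data_def)
  define p where "p = eigenpoly A B (\<eta> \<rho>) j"
  define P where "P = eigenpoly A B (\<eta> Empty)"
  note p = eigenpoly_facts[OF S1 \<rho>(2) \<eta>(1) nz(1) A B c degree_A degree_C, of j, folded p_def]
  note P = eigenpoly_facts_Empty[where \<eta>=\<eta>, OF S1 \<eta>0 degree_A degree_B, folded P_def]
  let ?F = "darboux_poly (Ag \<rho>) E p" and ?\<mu> = "eigenval A B (\<eta> \<rho>) j"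
  have nonres: "second_order_eigenvalue A B 0 k \<noteq> ?\<mu>" for k
  proof
    assume "second_order_eigenvalue A B 0 k = ?\<mu>"
    with S2 \<rho> have "Empty = \<rho>"
      unfolding S2_def P(3)[symmetric]
      by (auto dest!: inj_onD[where x = "(Empty, k)" and y = "(\<rho>, j)"] simp: gtypes_def)
    with \<rho>(1) show False by auto
  qed
  have ker: "z = 0" if "dual_darboux Ap s z = 0" for z
    by (rule dual_darboux_injective_I_II[OF split \<eta>(2) \<eta>0 \<rho> S1 S2 that])
  have Q: "exc_poly A B \<eta> Ag \<kappa> \<rho> j (int k) = ?F (P k)" for k
    using \<rho>(1) by (auto simp: exc_poly_def Let_def \<eta>(1) darboux_eq[OF nz(1)] p_def P_def)
  have "degree Ij \<le> Suc j" using Ij p(1) degree_pderiv[of Ij] by (simp add: p_def)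
  then have "degree (Ij * ?F (P n)) < Suc (n + Suc j) + degree p + 0"
    using degree_mult_le[of Ij "?F (P n)"] degree_darboux_poly_le[of p "P n"] p(1) P(1)[of n] by simp
  moreover have "p dvd dual_darboux Ap s (Ij * ?F (P n))"
    unfolding dual_darboux_mult Ij dual_darboux_darboux_poly[OF A B c p(3)] p_def[symmetric] by simp
  ultimately obtain z d where "dual_darboux Ap s z = 0"
    and "Ij * ?F (P n) = z + (\<Sum>k<Suc (n + Suc j). smult (d k) (?F (P k)))"
    using darboux_poly_expansion[OF p(3,2) nonres, of "Ij * ?F (P n)" "Suc (n + Suc j)" P]
      ker P(1,2) by (metis degree_0 zero_less_Suc)
  with ker show ?thesis unfolding Q by (metis add_0 lessThan_Suc_atMost)
qed

text \<open>The image of P_k carries index k + j + 1, and the constants left over from the kernel of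
  differentiation are multiples of the polynomial of index 0.\<close>

lemma exc_poly_expansion_III:
  assumes g: "gauge_data A B \<eta> Ag" and deg: "A \<noteq> 0" "degree A \<le> 2" "degree B \<le> 1"
    and III: "III \<in> gtypes A B" and "\<kappa> \<noteq> 0" and S1: "S1 A B \<eta>" and S2: "S2 A B \<eta>"
    and Ij: "pderiv Ij = eigenpoly A B (\<eta> III) j"
    and n: "exc_poly A B \<eta> Ag \<kappa> III j (int n) \<noteq> 0"
  shows "\<exists>d. Ij * exc_poly A B \<eta> Ag \<kappa> III j (int n) =
    (\<Sum>k\<le>n + Suc j. smult (d k) (exc_poly A B \<eta> Ag \<kappa> III j (int k)))"
proof -
  have "B \<noteq> pderiv A" using III by (auto simp: gtypes_def)
  with g have \<eta>: "\<eta> III = Fract (pderiv A - B) A" and Ag: "Ag III = A" and \<eta>0: "\<eta> Empty = 0"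
    by (auto simp: gauge_data_def)
  define E where "E = pderiv A - B"
  interpret gauge_split A B A 1 E 0 "coeff (pderiv E) 0" 1
    unfolding E_def by (rule gauge_split_III[OF deg])
  define p where "p = eigenpoly A B (\<eta> III) j"
  define P where "P = eigenpoly A B (\<eta> Empty)"
  note p = eigenpoly_facts[OF S1 III \<eta>[folded E_def] nz(1) A B c degree_A degree_C, of j, folded p_def]
  note P = eigenpoly_facts_Empty[where \<eta>=\<eta>, OF S1 \<eta>0 degree_A degree_B, folded P_def]
  let ?F = "darboux_poly A E p" and ?\<mu> = "eigenval A B (\<eta> III) j"
  let ?Q = "exc_poly A B \<eta> Ag \<kappa> III j"
  have nonres: "second_order_eigenvalue A B 0 k \<noteq> ?\<mu>" for k
  proof
    assume "second_order_eigenvalue A B 0 k = ?\<mu>"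
    with S2 III have "Empty = III"
      unfolding S2_def P(3)[symmetric]
      by (auto dest!: inj_onD[where x = "(Empty, k)" and y = "(III, j)"] simp: gtypes_def)
    then show False by simp
  qed
  have N: "dual_darboux 1 0 y = pderiv y" for y by (simp add: dual_darboux_def)
  have ker: "degree z = 0" if "dual_darboux 1 0 z = 0" for z :: "complex poly"
    using that by (simp add: N pderiv_eq_0_iff)
  have Q0: "?Q 0 = [:\<kappa>:]" and Q_gap: "\<And>k. 0 < k \<Longrightarrow> k \<le> j \<Longrightarrow> ?Q (int k) = 0"
    by (auto simp: exc_poly_def Let_def)
  have Q: "?Q (int (k + Suc j)) = ?F (P k)" for k
  proof -
    have "nat (int (k + Suc j)) - j - 1 = k" by simp
    then show ?thesis
      by (simp add: exc_poly_def Let_def \<eta> Ag darboux_eq[OF nz(1), folded E_def] p_def P_def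
          flip: E_def)
  qed
  have Qn: "degree (?Q (int n)) \<le> n" "p dvd pderiv (?Q (int n))"
  proof -
    \<comment> \<open>Nonvanishing excludes the gap 1, ..., j of indices.\<close>
    consider "n = 0" | k where "n = k + Suc j"
      using n Q_gap[of n] by (metis add.commute bot_nat_0.not_eq_extremum le_Suc_ex not_less_eq_eq)
    then have "degree (?Q (int n)) \<le> n \<and> p dvd pderiv (?Q (int n))"
    proof cases
      case 1
      then show ?thesis by (simp add: Q0)
    next
      case 2
      then show ?thesis
        using degree_darboux_poly_le[of p "P k"] p(1) P(1)[of k]
          dual_darboux_darboux_poly[OF A B c p(3), of "P k"] unfolding 2 Q N by simp
    qed
    then show "degree (?Q (int n)) \<le> n" "p dvd pderiv (?Q (int n))" by auto
  qed
  have "degree Ij \<le> Suc j" using Ij p(1) degree_pderiv[of Ij] by (simp add: p_def)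
  then have "degree (Ij * ?Q (int n)) < Suc n + degree p + 1"
    using degree_mult_le[of Ij "?Q (int n)"] Qn(1) p(1) by simp
  moreover have "p dvd dual_darboux 1 0 (Ij * ?Q (int n))"
    unfolding dual_darboux_mult Ij N using Qn(2) by (simp add: p_def)
  ultimately obtain z d where z: "dual_darboux 1 0 z = 0"
    and y: "Ij * ?Q (int n) = z + (\<Sum>k<Suc n. smult (d k) (?F (P k)))"
    using darboux_poly_expansion[OF p(3,2) nonres, of "Ij * ?Q (int n)" "Suc n" P]
      ker P(1,2) by (metis zero_less_Suc)
  from ker[OF z] obtain e where e: "z = [:e:]" by (metis degree_eq_zeroE)
  \<comment> \<open>Index 0 absorbs the kernel constant \<open>e\<close>, scaled by
    \<open>\<kappa>\<close>; the other coefficients move up by \<open>Suc j\<close>. In the gap the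
    truncated subtraction gives \<open>d 0\<close>, multiplied there by a zero polynomial.\<close>
  define d' where "d' k = (if k = 0 then e / \<kappa> else d (k - Suc j))" for k
  have "(\<Sum>k\<le>n + Suc j. smult (d' k) (?Q (int k))) =
      (\<Sum>k\<in>insert 0 {Suc j..n + Suc j}. smult (d' k) (?Q (int k)))"
    using Q_gap by (intro sum.mono_neutral_right) auto
  also have "\<dots> = z + (\<Sum>k = 0 + Suc j..n + Suc j. smult (d' k) (?Q (int k)))"
    using \<open>\<kappa> \<noteq> 0\<close> by (simp add: Q0 d'_def e)
  also have "\<dots> = z + (\<Sum>k\<le>n. smult (d k) (?F (P k)))"
    unfolding sum.shift_bounds_cl_nat_ivl Q by (simp add: d'_def atMost_atLeast0)
  also have "\<dots> = Ij * ?Q (int n)" unfolding y lessThan_Suc_atMost ..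
  finally show ?thesis by metis
qed

section \<open>The recurrence relation for the exceptional polynomials\<close>

theorem theorem3p1:
  fixes A B :: "complex poly"
    and \<eta> :: "gtype \<Rightarrow> ratfun" and Ag :: "gtype \<Rightarrow> complex poly"
    and w :: "real \<Rightarrow> complex" and a b :: ereal
    and \<rho> :: gtype and j :: nat
    and \<kappa> :: complex and Ij :: "complex poly"
  assumes "A \<noteq> 0" and "degree A \<le> 2" and "degree B = 1"
    and "gauge_data A B \<eta> Ag"
    and "a < b" and "weight_eq A B a b w"
    and "\<rho> \<in> {I, II, III}" and "\<rho> \<in> gtypes A B" and "\<kappa> \<noteq> 0"
    and "S1 A B \<eta>" and "S2 A B \<eta>" and "S3 A B \<eta> a b w" and "S4 A B \<eta> Ag \<kappa> a b w \<rho> j"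
    and "pderiv Ij = eigenpoly A B (\<eta> \<rho>) j"
  shows "\<forall>n\<in>exc_index A B \<eta> Ag \<kappa> \<rho> j. \<exists>\<beta> :: int \<Rightarrow> complex.
           Ij * exc_poly A B \<eta> Ag \<kappa> \<rho> j (int n) =
           (\<Sum>l = - int j - 1..int j + 1. smult (\<beta> l) (exc_poly A B \<eta> Ag \<kappa> \<rho> j (int n + l)))"
proof
  let ?Q = "exc_poly A B \<eta> Ag \<kappa> \<rho> j"
  fix n assume n: "n \<in> exc_index A B \<eta> Ag \<kappa> \<rho> j"
  define W where "W = (\<lambda>x::real. poly A (of_real x) * w x /
    (poly (Ag \<rho>) (of_real x) * poly (eigenpoly A B (\<eta> \<rho>) j) (of_real x))\<^sup>2)"
  from assms(13) obtain h where h: "\<And>m. ?Q (int m) \<noteq> 0 \<Longrightarrow> h m \<noteq> 0"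
    and orth: "\<And>m k. ?Q (int m) \<noteq> 0 \<Longrightarrow> ?Q (int k) \<noteq> 0 \<Longrightarrow>
      ((\<lambda>x. poly (?Q (int m)) (of_real x) * poly (?Q (int k)) (of_real x) * W x)
        has_integral (if m = k then h m else 0)) (einterval a b)"
    unfolding S4_def exc_index_def W_def by auto
  have "\<exists>\<beta>. Ij * ?Q (int n) = (\<Sum>l = - int (Suc j)..int (Suc j). smult (\<beta> l) (?Q (int n + l)))"
  \<comment> \<open>The half-width is \<open>Suc j\<close>, the reach of the upward expansions; (S4)
    supplies the pairing with weight \<open>W\<close>.\<close>
  proof (rule banded_recurrence[OF _ _ orth h])
    show "?Q m = 0" if "m < 0" for m using that by (simp add: exc_poly_def)
  next
    fix m assume "?Q (int m) \<noteq> 0"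
    with assms show "\<exists>d. Ij * ?Q (int m) = (\<Sum>k\<le>m + Suc j. smult (d k) (?Q (int k)))"
      using exc_poly_expansion_I_II[of A B \<eta> Ag \<rho> Ij j \<kappa> m]
        exc_poly_expansion_III[of A B \<eta> Ag \<kappa> Ij j m]
      by auto
  next
    show "?Q (int n) \<noteq> 0" using n by (simp add: exc_index_def)
  qed
  moreover have "- int (Suc j) = - int j - 1" "int (Suc j) = int j + 1" by simp_all
  ultimately show "\<exists>\<beta>. Ij * ?Q (int n) =
      (\<Sum>l = - int j - 1..int j + 1. smult (\<beta> l) (?Q (int n + l)))"
    by (simp only:)
qed

end
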